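(* Let $m\ge 1$, let $\mathcal M$ be a set of $m$ goods, $\mathcal B$ a set of $m$ buyers, and let $\mathbf V=(v_{i,j})_{i\in\mathcal B,\,j\in\mathcal M}$ be any valuation matrix with $v_{i,j}\ge 0$. Then the skewed-set aided descending price auction, run on input $\mathbf V$, always returns the maximum market-clearing price vector of the market.
   Context: Market. Each buyer $i\in\mathcal B$ wants at most one good and values good $j\in\mathcal M$ at $v_{i,j}\ge 0$; $|\mathcal B|=|\mathcal M|=m$; there is one copy of each good. For a price vector $\mathbf P=(P_j)_{j\in\mathcal M}$ (real entries), put $U_i^*=\max\{0,\max_{j\in\mathcal M}(v_{i,j}-P_j)\}$ and $L_i=\{j\in\mathcal M: v_{i,j}-P_j=U_i^*\}$ (possibly empty). The preference graph at $\mathbf P$ is the bipartite graph between $\mathcal M$ and $\mathcal B$ in which $j\in\mathcal M$ and $i\in\mathcal B$ are adjacent iff $j\in L_i$. $N(S)$ denotes the set of neighbors of a vertex set $S$ in the preference graph. $\mathbf P$ is a market-clearing price vector (MCP) if its preference graph contains a perfect matching. It is known that the set of MCPs has an element-wise largest element; it is called the maximum MCP. A set $S\subseteq\mathcal M$ is a constricted good set if $|S|>|N(S)|$. The skewness of a non-empty $S\subseteq\mathcal M$ is $f(S)=|S|-|N(S)|+\frac1{|S|}$. When the preference graph has no perfect matching, there is a unique non-empty set of goods maximizing $f$; it is called the maximally skewed set. Skewed-set aided descending price auction. Initialize $P_j=\max_{i\in\mathcal B}v_{i,j}$ for every $j\in\mathcal M$ and construct the preference graph. While there exists a constricted good set (equivalently,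 while the preference graph has no perfect matching): let $S$ be the maximally skewed set of the current preference graph; decrease $P_j$, for all $j\in S$ simultaneously, by $$\min_{i\in\mathcal B\setminus N(S),\ l\in S}\Big\{\max\big\{0,\max_{k\in\mathcal M\setminus S}(v_{i,k}-P_k)\big\}-(v_{i,l}-P_l)\Big\}$$ (the inner maximum over an empty set being $-\infty$), leave the other prices unchanged, and reconstruct the preference graph. When no constricted good set exists, return $\mathbf P$. *)

theory Defs
  imports Complex_Main "HOL-Library.Cardinality" "HOL-Library.While_Combinator"
begin

text \<open>
  Buyers and goods are the elements of two finite types. A valuation matrix is a function
  \<open>v :: 'b \<Rightarrow> 'g \<Rightarrow> real\<close> (buyer first) and a price vector a function \<open>P :: 'g \<Rightarrow> real\<close>, so that
  the pointwise order on functions is the element-wise order on price vectors.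
\<close>

definition max_utility :: "('b::finite \<Rightarrow> 'g::finite \<Rightarrow> real) \<Rightarrow> ('g \<Rightarrow> real) \<Rightarrow> 'b \<Rightarrow> real" where
  "max_utility v P i = max 0 (MAX j. v i j - P j)"

definition preferred_goods ::
    "('b::finite \<Rightarrow> 'g::finite \<Rightarrow> real) \<Rightarrow> ('g \<Rightarrow> real) \<Rightarrow> 'b \<Rightarrow> 'g set" where
  "preferred_goods v P i = {j. v i j - P j = max_utility v P i}"

text \<open>A bipartite graph between goods and buyers is given by its set of (good, buyer) edges.\<close>

definition preference_graph ::
    "('b::finite \<Rightarrow> 'g::finite \<Rightarrow> real) \<Rightarrow> ('g \<Rightarrow> real) \<Rightarrow> ('g \<times> 'b) set" where
  "preference_graph v P = {(j, i). j \<in> preferred_goods v P i}"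

definition neighbours ::
    "('b::finite \<Rightarrow> 'g::finite \<Rightarrow> real) \<Rightarrow> ('g \<Rightarrow> real) \<Rightarrow> 'g set \<Rightarrow> 'b set" where
  "neighbours v P S = preference_graph v P `` S"

definition perfect_matching :: "('g \<times> 'b) set \<Rightarrow> ('g \<times> 'b) set \<Rightarrow> bool" where
  "perfect_matching E F \<longleftrightarrow>
     F \<subseteq> E \<and> (\<forall>j. \<exists>!i. (j, i) \<in> F) \<and> (\<forall>i. \<exists>!j. (j, i) \<in> F)"

definition market_clearing ::
    "('b::finite \<Rightarrow> 'g::finite \<Rightarrow> real) \<Rightarrow> ('g \<Rightarrow> real) \<Rightarrow> bool" where
  "market_clearing v P \<longleftrightarrow> (\<exists>F. perfect_matching (preference_graph v P) F)"

definition maximum_market_clearing ::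
    "('b::finite \<Rightarrow> 'g::finite \<Rightarrow> real) \<Rightarrow> ('g \<Rightarrow> real) \<Rightarrow> bool" where
  "maximum_market_clearing v P \<longleftrightarrow>
     market_clearing v P \<and> (\<forall>Q. market_clearing v Q \<longrightarrow> Q \<le> P)"

definition constricted ::
    "('b::finite \<Rightarrow> 'g::finite \<Rightarrow> real) \<Rightarrow> ('g \<Rightarrow> real) \<Rightarrow> 'g set \<Rightarrow> bool" where
  "constricted v P S \<longleftrightarrow> card S > card (neighbours v P S)"

definition skewness ::
    "('b::finite \<Rightarrow> 'g::finite \<Rightarrow> real) \<Rightarrow> ('g \<Rightarrow> real) \<Rightarrow> 'g set \<Rightarrow> real" where
  "skewness v P S = real (card S) - real (card (neighbours v P S)) + 1 / real (card S)"

text \<open>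
  The description below determines a set whenever the preference graph has no perfect matching,
  which is the only situation in which the auction refers to it.
\<close>

definition maximally_skewed_set ::
    "('b::finite \<Rightarrow> 'g::finite \<Rightarrow> real) \<Rightarrow> ('g \<Rightarrow> real) \<Rightarrow> 'g set" where
  "maximally_skewed_set v P =
     (THE S. S \<noteq> {} \<and> (\<forall>T. T \<noteq> {} \<longrightarrow> skewness v P T \<le> skewness v P S))"

text \<open>
  Taking the maximum over the outside goods together with \<open>0\<close> gives \<open>0\<close> when \<open>S\<close> contains
  all goods, as does the convention that a maximum over the empty set is minus infinity.
\<close>

definition price_decrement ::
    "('b::finite \<Rightarrow> 'g::finite \<Rightarrow> real) \<Rightarrow> ('g \<Rightarrow> real) \<Rightarrow> 'g set \<Rightarrow> real" where
  "price_decrement v P S =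
     (MIN (i, l) \<in> (- neighbours v P S) \<times> S.
        Max (insert 0 ((\<lambda>k. v i k - P k) ` (- S))) - (v i l - P l))"

definition initial_prices :: "('b::finite \<Rightarrow> 'g::finite \<Rightarrow> real) \<Rightarrow> 'g \<Rightarrow> real" where
  "initial_prices v j = (MAX i. v i j)"

definition auction_step ::
    "('b::finite \<Rightarrow> 'g::finite \<Rightarrow> real) \<Rightarrow> ('g \<Rightarrow> real) \<Rightarrow> 'g \<Rightarrow> real" where
  "auction_step v P =
     (let S = maximally_skewed_set v P
      in (\<lambda>j. if j \<in> S then P j - price_decrement v P S else P j))"

text \<open>The result is \<open>None\<close> if the loop does not terminate.\<close>

definition skewed_set_auction ::
    "('b::finite \<Rightarrow> 'g::finite \<Rightarrow> real) \<Rightarrow> ('g \<Rightarrow> real) option" where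
  "skewed_set_auction v =
     while_option (\<lambda>P. \<exists>S. constricted v P S) (auction_step v) (initial_prices v)"

end

(*
  Write g(S) = |S| - |N(S)|, so that the maximally skewed set S is the smallest maximiser of the
  supermodular function g.  Two facts carry the proof.

  Upper bound: every market-clearing Q stays below the current prices P.  If lowering S by d
  overshot Q, let T be the goods of S on which P - Q is smallest.  Every buyer preferring some
  good of T at Q lies in N(S) - N(S - T), so |T| \<le> |N(S)| - |N(S - T)|, and then S - T is more
  skewed than S, or S is not constricted.

  Termination: if N' denotes neighbours after the step and T = A \<union> B with A inside S and B
  outside, then N'(T) contains N(A) and N(B) - N(S), hence
  g'(T) \<le> g(A) + g(S \<union> B) - g(S) \<le> g(A).  Since also N(S) is a proper subset of N'(S), the
  maximal skewness strictly decreases, and it takes only finitely many values.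
*)
theory Submission
  imports Defs
begin

section \<open>Hall's theorem\<close>

text \<open>Rado's argument: if some \<open>N x\<close> contains two elements, one of them can be deleted without
  violating Hall's condition, for otherwise two violating sets contradict it at their union
  and intersection.\<close>

theorem hall:
  fixes N :: "'a \<Rightarrow> 'b set"
  assumes "finite A" and "\<And>x. x \<in> A \<Longrightarrow> finite (N x)"
    and "\<And>X. X \<subseteq> A \<Longrightarrow> card X \<le> card (\<Union> (N ` X))"
  shows "\<exists>h. inj_on h A \<and> (\<forall>x\<in>A. h x \<in> N x)"
  using assms(2,3)
proof (induction "\<Sum>x\<in>A. card (N x)" arbitrary: N rule: less_induct)
  case less
  note fin = less.prems(1) and hall = less.prems(2)
  have nonempty: "card (N x) \<ge> 1" if "x \<in> A" for x
    using hall[of "{x}"] that by simp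
  show ?case
  proof (cases "\<forall>x\<in>A. card (N x) = 1")
    case True
    then have "\<forall>x\<in>A. \<exists>y. N x = {y}"
      by (simp add: card_1_singleton_iff)
    then obtain h where h: "\<And>x. x \<in> A \<Longrightarrow> N x = {h x}"
      by metis
    have "inj_on h A"
    proof (rule inj_onI, rule ccontr)
      fix x y assume xy: "x \<in> A" "y \<in> A" "h x = h y" "x \<noteq> y"
      then show False
        using hall[of "{x, y}"] h[of x] h[of y] by simp
    qed
    then show ?thesis
      using h by auto
  next
    case False
    then obtain x where x: "x \<in> A" "card (N x) \<ge> 2"
      using nonempty by force
    then obtain a b where ab: "a \<in> N x" "b \<in> N x" "a \<noteq> b"
      using card_le_Suc0_iff_eq[OF fin[OF x(1)]] by auto
    define D where "D c = N(x := N x - {c})" for c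
    have shrink: "\<exists>h. inj_on h A \<and> (\<forall>x\<in>A. h x \<in> N x)"
      if c: "c \<in> N x" and hall': "\<And>X. X \<subseteq> A \<Longrightarrow> card X \<le> card (\<Union> (D c ` X))" for c
    proof -
      have "card (D c x) < card (N x)"
        using card_Diff1_less[OF fin[OF x(1)] c] by (simp add: D_def)
      moreover have le: "D c y \<subseteq> N y" for y
        by (auto simp: D_def)
      ultimately have "(\<Sum>x\<in>A. card (D c x)) < (\<Sum>x\<in>A. card (N x))"
        using x(1) \<open>finite A\<close> fin by (intro sum_strict_mono_ex1) (auto intro: card_mono)
      moreover have "finite (D c y)" if "y \<in> A" for y
        using fin[OF that] le finite_subset by blast
      ultimately show ?thesis
        using less.hyps[of "D c"] hall' le by blast
    qed
    \<comment> \<open>Only \<open>N x\<close> was shrunk, so a set violating Hall's condition for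
      \<open>D c\<close> contains \<open>x\<close>. Dropping \<open>x\<close> lowers its size by
      one, which turns the strict inequality into the weak one stated here.\<close>
    have violation: "\<exists>X \<subseteq> A - {x}. card (\<Union> (N ` X) \<union> (N x - {c})) \<le> card X"
      if "X \<subseteq> A" "\<not> card X \<le> card (\<Union> (D c ` X))" for c X
    proof -
      have "x \<in> X"
      proof (rule ccontr)
        assume "x \<notin> X"
        then have "D c ` X = N ` X"
          by (auto simp: D_def)
        then show False
          using that hall[of X] by simp
      qed
      then have split: "\<Union> (D c ` X) = \<Union> (N ` (X - {x})) \<union> (N x - {c})"
        by (auto simp: D_def)
      have "card X = Suc (card (X - {x}))"
        using \<open>x \<in> X\<close> that(1) \<open>finite A\<close> by (metis card_Suc_Diff1 finite_subset)
      then have "card (\<Union> (N ` (X - {x})) \<union> (N x - {c})) \<le> card (X - {x})"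
        using that(2) unfolding split by linarith
      moreover have "X - {x} \<subseteq> A - {x}"
        using that(1) by auto
      ultimately show ?thesis
        by (intro exI conjI)
    qed
    show ?thesis
    proof (rule ccontr)
      assume none: "\<not> ?thesis"
      have deficit: "\<exists>X \<subseteq> A - {x}. card (\<Union> (N ` X) \<union> (N x - {c})) \<le> card X" if "c \<in> N x" for c
      proof (rule ccontr)
        assume "\<not> (\<exists>X \<subseteq> A - {x}. card (\<Union> (N ` X) \<union> (N x - {c})) \<le> card X)"
        then have "card X \<le> card (\<Union> (D c ` X))" if "X \<subseteq> A" for X
          using violation[OF that, of c] by argo
        then show False
          using shrink[OF that] none by argo
      qed
      obtain X where X: "X \<subseteq> A - {x}" "card (\<Union> (N ` X) \<union> (N x - {a})) \<le> card X"
        using deficit[OF ab(1)] by (elim exE conjE)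
      obtain Y where Y: "Y \<subseteq> A - {x}" "card (\<Union> (N ` Y) \<union> (N x - {b})) \<le> card Y"
        using deficit[OF ab(2)] by (elim exE conjE)
      let ?U = "\<Union> (N ` X) \<union> (N x - {a})" and ?W = "\<Union> (N ` Y) \<union> (N x - {b})"
      have finXY: "finite X" "finite Y"
        using X(1) Y(1) \<open>finite A\<close> by (auto intro: finite_subset)
      have finUW: "finite ?U" "finite ?W"
        using X(1) Y(1) finXY fin x(1) by auto
      \<comment> \<open>Since \<open>a\<close> and \<open>b\<close> differ, the two reduced copies
        of \<open>N x\<close> together restore \<open>N x\<close>. The element \<open>x\<close>
        gained in the union is the extra unit that contradicts the two deficits.\<close>
      have "?U \<union> ?W = \<Union> (N ` insert x (X \<union> Y))"
        using ab by auto
      moreover have "card (insert x (X \<union> Y)) = Suc (card (X \<union> Y))"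
        using X(1) Y(1) finXY by (subst card_insert_disjoint) auto
      moreover have "insert x (X \<union> Y) \<subseteq> A"
        using X(1) Y(1) x(1) by auto
      ultimately have "Suc (card (X \<union> Y)) \<le> card (?U \<union> ?W)"
        using hall by metis
      moreover have "card (X \<inter> Y) \<le> card (?U \<inter> ?W)"
      proof -
        have "card (X \<inter> Y) \<le> card (\<Union> (N ` (X \<inter> Y)))"
          using X(1) by (intro hall) auto
        also have "\<dots> \<le> card (?U \<inter> ?W)"
          using finUW by (intro card_mono) auto
        finally show ?thesis .
      qed
      ultimately show False
        using card_Un_Int[OF finXY] card_Un_Int[OF finUW] X(2) Y(2) by linarith
    qed
  qed
qed


section \<open>Preference graphs and market clearing\<close>

text \<open>A utility equals the maximum iff it dominates 0 and all other utilities. This removes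
  both maxima from all later arguments.\<close>

lemma in_neighbours_iff:
  "i \<in> neighbours v P S \<longleftrightarrow>
     (\<exists>l\<in>S. 0 \<le> v i l - P l \<and> (\<forall>k. v i k - P k \<le> v i l - P l))"
proof -
  have "v i l - P l = max_utility v P i \<longleftrightarrow>
      0 \<le> v i l - P l \<and> (\<forall>k. v i k - P k \<le> v i l - P l)" for l
  proof -
    let ?M = "MAX j. v i j - P j"
    have "?M \<ge> v i k - P k" for k
      by (intro Max_ge) auto
    moreover obtain j where "?M = v i j - P j"
      using Max_in[of "range (\<lambda>j. v i j - P j)"] by fastforce
    ultimately show ?thesis
      unfolding max_utility_def by (smt (verit))
  qed
  then show ?thesis
    by (auto simp: neighbours_def preference_graph_def preferred_goods_def Image_iff)
qed

lemma neighbours_Un: "neighbours v P (S \<union> T) = neighbours v P S \<union> neighbours v P T"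
  by (auto simp: neighbours_def)

lemma neighbours_mono: "S \<subseteq> T \<Longrightarrow> neighbours v P S \<subseteq> neighbours v P T"
  by (auto simp: neighbours_def)

lemma market_clearing_imp_assignment:
  assumes "market_clearing v P"
  shows "\<exists>h. inj h \<and> (\<forall>j. h j \<in> neighbours v P {j})"
proof -
  obtain F where F: "F \<subseteq> preference_graph v P"
      "\<And>j. \<exists>!i. (j, i) \<in> F" "\<And>i. \<exists>!j. (j, i) \<in> F"
    using assms by (auto simp: market_clearing_def perfect_matching_def)
  obtain h where h: "\<And>j. (j, h j) \<in> F"
    using F(2) by metis
  have "inj h"
    using h F(3) by (metis injI)
  then show ?thesis
    using h F(1) by (auto simp: neighbours_def)
qed

text \<open>Equal finite cardinalities make the injection \<open>h\<close> a bijection, so every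
  buyer is matched as well.\<close>

lemma assignment_imp_market_clearing:
  fixes v :: "'b::finite \<Rightarrow> 'g::finite \<Rightarrow> real"
  assumes "CARD('g) = CARD('b)" and "inj h" and "\<And>j. h j \<in> neighbours v P {j}"
  shows "market_clearing v P"
proof -
  have "surj h"
    using assms(1,2) by (metis card_image card_subset_eq finite top_greatest)
  then have "perfect_matching (preference_graph v P) {(j, h j) | j. True}"
    using assms(2,3) unfolding perfect_matching_def neighbours_def
    by (auto dest: injD)
  then show ?thesis
    by (auto simp: market_clearing_def)
qed

text \<open>Absence of constricted sets is exactly Hall's condition for the family of neighbourhoods
  of single goods.\<close>

lemma market_clearing_if_not_constricted:
  fixes v :: "'b::finite \<Rightarrow> 'g::finite \<Rightarrow> real"
  assumes "CARD('g) = CARD('b)" and "\<nexists>S. constricted v P S"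
  shows "market_clearing v P"
proof -
  have "\<exists>h. inj_on h UNIV \<and> (\<forall>j\<in>UNIV. h j \<in> neighbours v P {j})"
  proof (rule hall)
    fix X :: "'g set"
    have "neighbours v P X = (\<Union>j\<in>X. neighbours v P {j})"
      by (auto simp: neighbours_def)
    then show "card X \<le> card (\<Union>j\<in>X. neighbours v P {j})"
      using assms(2) by (metis constricted_def leI)
  qed auto
  then show ?thesis
    using assignment_imp_market_clearing[OF assms(1)] by auto
qed


section \<open>The maximally skewed set\<close>

text \<open>The function g of the overview. Type \<open>int\<close> avoids truncated subtraction and
  makes distinct values differ by at least 1.\<close>

definition surplus ::
    "('b::finite \<Rightarrow> 'g::finite \<Rightarrow> real) \<Rightarrow> ('g \<Rightarrow> real) \<Rightarrow> 'g set \<Rightarrow> int" where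
  "surplus v P S = int (card S) - int (card (neighbours v P S))"

lemma skewness_eq: "skewness v P S = real_of_int (surplus v P S) + 1 / real (card S)"
  by (simp add: skewness_def surplus_def)

lemma surplus_empty: "surplus v P {} = 0"
  by (simp add: surplus_def neighbours_def)

text \<open>Cardinality is modular and the size of the neighbourhood is submodular: the
  neighbourhood of an intersection lies in the intersection of the neighbourhoods.\<close>

lemma surplus_supermodular:
  "surplus v P S + surplus v P T \<le> surplus v P (S \<union> T) + surplus v P (S \<inter> T)"
proof -
  have "card (neighbours v P (S \<inter> T)) \<le> card (neighbours v P S \<inter> neighbours v P T)"
    by (intro card_mono) (auto simp: neighbours_def)
  then show ?thesis
    using card_Un_Int[of S T] card_Un_Int[of "neighbours v P S" "neighbours v P T"]
    unfolding surplus_def neighbours_Un by auto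
qed

text \<open>The fractional term lies in (0,1], so it cannot reverse a difference between integers.
  It only breaks ties, in favour of smaller sets.\<close>

lemma skewness_le_iff:
  assumes "S \<noteq> {}" and "T \<noteq> {}"
  shows "skewness v P T \<le> skewness v P S \<longleftrightarrow>
    surplus v P T < surplus v P S \<or> surplus v P T = surplus v P S \<and> card S \<le> card T"
proof -
  have pos: "card S > 0" "card T > 0"
    using assms by (auto simp: card_gt_0_iff)
  have bound: "0 < 1 / real (card S)" "1 / real (card S) \<le> 1"
      "0 < 1 / real (card T)" "1 / real (card T) \<le> 1"
    using pos by auto
  have "1 / real (card T) \<le> 1 / real (card S) \<longleftrightarrow> card S \<le> card T"
    using pos by (simp add: divide_simps)
  moreover have "skewness v P T \<le> skewness v P S" if "surplus v P T < surplus v P S"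
  proof -
    have "real_of_int (surplus v P T) + 1 \<le> real_of_int (surplus v P S)"
      using that by linarith
    then show ?thesis
      using bound unfolding skewness_eq by linarith
  qed
  moreover have "\<not> skewness v P T \<le> skewness v P S" if "surplus v P T > surplus v P S"
  proof -
    have "real_of_int (surplus v P S) + 1 \<le> real_of_int (surplus v P T)"
      using that by linarith
    then show ?thesis
      using bound unfolding skewness_eq by linarith
  qed
  moreover have "skewness v P T \<le> skewness v P S \<longleftrightarrow> 1 / real (card T) \<le> 1 / real (card S)"
    if "surplus v P T = surplus v P S"
    using that by (simp add: skewness_eq)
  ultimately show ?thesis
    by linarith
qed

text \<open>Justifies the description operator and replaces skewness by the smallest maximiser of
  \<open>surplus\<close>. The comparisons also cover \<open>T = {}\<close>, because a constricted
  set makes the maximal surplus positive.\<close>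

lemma maximally_skewed_set:
  fixes v :: "'b::finite \<Rightarrow> 'g::finite \<Rightarrow> real"
  assumes "constricted v P C"
  defines "S \<equiv> maximally_skewed_set v P"
  shows "S \<noteq> {}" and "surplus v P S > 0" and "surplus v P T \<le> surplus v P S"
    and "surplus v P T = surplus v P S \<Longrightarrow> card S \<le> card T"
proof -
  let ?max = "\<lambda>S. S \<noteq> {} \<and> (\<forall>T. T \<noteq> {} \<longrightarrow> skewness v P T \<le> skewness v P S)"
  have C: "surplus v P C > 0" "C \<noteq> {}"
    using assms(1) by (auto simp: constricted_def surplus_def)
  have pos: "surplus v P X > 0" if "?max X" for X
  proof -
    have "X \<noteq> {}" "skewness v P C \<le> skewness v P X"
      using that C(2) by blast+
    then show ?thesis
      using C skewness_le_iff[of X C v P] by linarith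
  qed
  have le: "surplus v P T \<le> surplus v P X" if "?max X" for X T
  proof (cases "T = {}")
    case True
    then show ?thesis
      using pos[OF that] surplus_empty[of v P] by simp
  next
    case False
    then have "X \<noteq> {}" "skewness v P T \<le> skewness v P X"
      using that by blast+
    then show ?thesis
      using False skewness_le_iff[of X T v P] by linarith
  qed
  have least: "card X \<le> card T" if "?max X" and "surplus v P T = surplus v P X" for X T
  proof -
    have T: "T \<noteq> {}"
      using that(2) pos[OF that(1)] surplus_empty[of v P] by force
    then have "X \<noteq> {}" "skewness v P T \<le> skewness v P X"
      using that(1) by blast+
    then show ?thesis
      using T that(2) skewness_le_iff[of X T v P] by linarith
  qed
  have "\<exists>X. ?max X"
  proof -
    let ?V = "skewness v P ` (- {{}})"
    have "Max ?V \<in> ?V"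
      using C(2) by (intro Max_in) auto
    then obtain X where X: "X \<noteq> {}" "Max ?V = skewness v P X"
      by auto
    have "skewness v P T \<le> Max ?V" if "T \<noteq> {}" for T
      using that by (intro Max_ge) auto
    with X show ?thesis
      by auto
  qed
  moreover have "X = Y" if X: "?max X" and Y: "?max Y" for X Y
  proof -
    have "X \<noteq> {}" "Y \<noteq> {}"
      and "skewness v P X \<le> skewness v P Y" "skewness v P Y \<le> skewness v P X"
      using X Y by blast+
    then have eq: "surplus v P X = surplus v P Y" "card X = card Y"
      using skewness_le_iff[of X Y v P] skewness_le_iff[of Y X v P] by linarith+
    have top: "surplus v P T \<le> surplus v P X" for T
      using X by (rule le)
    \<comment> \<open>Uniqueness: by supermodularity the intersection of two maximisers is again
      one, and minimal size then makes it equal to both.\<close>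
    have "surplus v P (X \<inter> Y) \<ge> surplus v P X"
      using surplus_supermodular[of v P X Y] top[of "X \<union> Y"] eq by linarith
    then have "surplus v P (X \<inter> Y) = surplus v P X"
      using top[of "X \<inter> Y"] by linarith
    then have "card X \<le> card (X \<inter> Y)"
      by (rule least[OF X])
    then have "X \<inter> Y = X" and "X \<inter> Y = Y"
      using eq(2) by (intro card_seteq; auto)+
    then show "X = Y"
      by blast
  qed
  ultimately have "\<exists>!X. ?max X"
    by (rule ex_ex1I)
  then have S: "?max S"
    unfolding S_def maximally_skewed_set_def by (rule theI')
  show "S \<noteq> {}"
    using S by blast
  show "surplus v P S > 0"
    using S by (rule pos)
  show "surplus v P T \<le> surplus v P S"
    using S by (rule le)
  show "card S \<le> card T" if "surplus v P T = surplus v P S"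
    using S that by (rule least)
qed


section \<open>One step of the auction\<close>

text \<open>The minuend in \<open>price_decrement\<close>. It depends only on prices outside
  \<open>S\<close>, so lowering the prices in \<open>S\<close> leaves it unchanged.\<close>

definition outside_utility ::
    "('b::finite \<Rightarrow> 'g::finite \<Rightarrow> real) \<Rightarrow> ('g \<Rightarrow> real) \<Rightarrow> 'g set \<Rightarrow> 'b \<Rightarrow> real" where
  "outside_utility v P S i = Max (insert 0 ((\<lambda>k. v i k - P k) ` (- S)))"

lemma outside_utility_nonneg: "0 \<le> outside_utility v P S i"
  by (simp add: outside_utility_def)

lemma outside_utility_ge: "k \<notin> S \<Longrightarrow> v i k - P k \<le> outside_utility v P S i"
  by (auto simp: outside_utility_def intro: Max_ge)

lemma outside_utility_le:
  assumes "0 \<le> u" and "\<And>k. k \<notin> S \<Longrightarrow> v i k - P k \<le> u"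
  shows "outside_utility v P S i \<le> u"
  using assms by (auto simp: outside_utility_def)

text \<open>The decrement is a minimum over such pairs: for a buyer outside the neighbourhood, no
  good of \<open>S\<close> can overtake the best outside option.\<close>

lemma price_decrement_le:
  assumes "i \<notin> neighbours v P S" and "l \<in> S"
  shows "v i l - P l + price_decrement v P S \<le> outside_utility v P S i"
proof -
  have "price_decrement v P S \<le> outside_utility v P S i - (v i l - P l)"
    unfolding price_decrement_def outside_utility_def[symmetric]
    using assms by (intro Min_le) (auto intro!: image_eqI[of _ _ "(i, l)"])
  then show ?thesis
    by simp
qed

lemma price_decrement_attained:
  assumes "neighbours v P S \<noteq> UNIV" and "S \<noteq> {}"
  shows "\<exists>i l. i \<notin> neighbours v P S \<and> l \<in> S \<and>
    v i l - P l + price_decrement v P S = outside_utility v P S i"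
proof -
  have "price_decrement v P S \<in> (\<lambda>(i, l). outside_utility v P S i - (v i l - P l))
      ` ((- neighbours v P S) \<times> S)"
    unfolding price_decrement_def outside_utility_def[symmetric]
    using assms by (intro Min_in) auto
  then show ?thesis
    by (force simp: algebra_simps)
qed

text \<open>Otherwise the buyer's best good in \<open>S\<close> would dominate 0 and all other
  goods, making the buyer a neighbour of \<open>S\<close>.\<close>

lemma utility_less_outside_utility:
  assumes "i \<notin> neighbours v P S" and "l \<in> S"
  shows "v i l - P l < outside_utility v P S i"
proof (rule ccontr)
  assume "\<not> ?thesis"
  moreover obtain l' where l': "l' \<in> S" "\<And>k. k \<in> S \<Longrightarrow> v i k - P k \<le> v i l' - P l'"
  proof -
    have "Max ((\<lambda>k. v i k - P k) ` S) \<in> (\<lambda>k. v i k - P k) ` S"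
      using assms(2) by (intro Max_in) auto
    then obtain l' where "l' \<in> S" "Max ((\<lambda>k. v i k - P k) ` S) = v i l' - P l'"
      by blast
    then show ?thesis
      using that Max_ge[of "(\<lambda>k. v i k - P k) ` S"] by auto
  qed
  ultimately have "outside_utility v P S i \<le> v i l' - P l'"
    using l'(2)[OF assms(2)] by linarith
  then have "0 \<le> v i l' - P l' \<and> (\<forall>k. v i k - P k \<le> v i l' - P l')"
    using l'(2) outside_utility_nonneg[of v P S i] outside_utility_ge[of _ S v i P]
    by (metis order_trans)
  then show False
    using assms(1) l'(1) by (auto simp: in_neighbours_iff)
qed

lemma price_decrement_pos:
  assumes "neighbours v P S \<noteq> UNIV" and "S \<noteq> {}"
  shows "price_decrement v P S > 0"
proof -
  obtain i l where "i \<notin> neighbours v P S" "l \<in> S"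
      "v i l - P l + price_decrement v P S = outside_utility v P S i"
    using price_decrement_attained[OF assms] by blast
  then show ?thesis
    using utility_less_outside_utility[of i v P S l] by linarith
qed

text \<open>The auction step for an arbitrary set \<open>S\<close>, which separates the effect on
  neighbourhoods from the choice of \<open>S\<close>.\<close>

definition lower_prices ::
    "('b::finite \<Rightarrow> 'g::finite \<Rightarrow> real) \<Rightarrow> 'g set \<Rightarrow> ('g \<Rightarrow> real) \<Rightarrow> 'g \<Rightarrow> real" where
  "lower_prices v S P = (\<lambda>j. if j \<in> S then P j - price_decrement v P S else P j)"

lemma auction_step_eq: "auction_step v P = lower_prices v (maximally_skewed_set v P) P"
  by (simp add: auction_step_def lower_prices_def Let_def)

text \<open>All goods of \<open>S\<close> gain the same positive utility and the others gain
  nothing, so a preferred good in \<open>A\<close> stays preferred.\<close>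

lemma neighbours_lower_prices_inside:
  assumes "neighbours v P S \<noteq> UNIV" and "S \<noteq> {}" and "A \<subseteq> S"
  shows "neighbours v P A \<subseteq> neighbours v (lower_prices v S P) A"
proof
  fix i assume "i \<in> neighbours v P A"
  then obtain l where l: "l \<in> A" "0 \<le> v i l - P l" "\<And>k. v i k - P k \<le> v i l - P l"
    by (auto simp: in_neighbours_iff)
  have "v i k - lower_prices v S P k \<le> v i l - lower_prices v S P l" for k
    using l(1) l(3)[of k] assms(3) price_decrement_pos[OF assms(1,2)]
    by (auto simp: lower_prices_def)
  moreover have "0 \<le> v i l - lower_prices v S P l"
    using l(1,2) assms(3) price_decrement_pos[OF assms(1,2)] by (auto simp: lower_prices_def)
  ultimately show "i \<in> neighbours v (lower_prices v S P) A"
    using l(1) by (auto simp: in_neighbours_iff)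
qed

text \<open>Such a buyer's preferred good in \<open>B\<close> attains at least
  \<open>outside_utility\<close>, which no lowered price lets a good of \<open>S\<close>
  exceed.\<close>

lemma neighbours_lower_prices_outside:
  assumes "B \<inter> S = {}"
  shows "neighbours v P B - neighbours v P S \<subseteq> neighbours v (lower_prices v S P) B"
proof
  fix i assume i: "i \<in> neighbours v P B - neighbours v P S"
  then obtain l where l: "l \<in> B" "0 \<le> v i l - P l" "\<And>k. v i k - P k \<le> v i l - P l"
    by (auto simp: in_neighbours_iff)
  have "outside_utility v P S i \<le> v i l - P l"
    using l by (intro outside_utility_le) auto
  then have "v i k - lower_prices v S P k \<le> v i l - lower_prices v S P l" for k
    using l(1) l(3)[of k] assms i price_decrement_le[of i v P S k]
    by (auto simp: lower_prices_def)
  moreover have "0 \<le> v i l - lower_prices v S P l"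
    using l(1,2) assms by (auto simp: lower_prices_def)
  ultimately show "i \<in> neighbours v (lower_prices v S P) B"
    using l(1) by (auto simp: in_neighbours_iff)
qed

text \<open>A pair attaining the minimum supplies the new neighbour: its good now ties with the
  buyer's best outside option.\<close>

lemma neighbours_lower_prices_strict:
  assumes "neighbours v P S \<noteq> UNIV" and "S \<noteq> {}"
  shows "neighbours v P S \<subset> neighbours v (lower_prices v S P) S"
proof -
  obtain i l where il: "i \<notin> neighbours v P S" "l \<in> S"
      "v i l - P l + price_decrement v P S = outside_utility v P S i"
    using price_decrement_attained[OF assms] by blast
  have "v i k - lower_prices v S P k \<le> v i l - lower_prices v S P l" for k
    using il price_decrement_le[OF il(1), of k] outside_utility_ge[of k S v i P]
    by (auto simp: lower_prices_def)
  moreover have "0 \<le> v i l - lower_prices v S P l"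
    using il(2,3) outside_utility_nonneg[of v P S i] by (simp add: lower_prices_def)
  ultimately have "i \<in> neighbours v (lower_prices v S P) S"
    using il(2) by (auto simp: in_neighbours_iff)
  then show ?thesis
    using il(1) neighbours_lower_prices_inside[OF assms order_refl] by blast
qed

text \<open>Ensures that the minimum in \<open>price_decrement\<close> has a buyer to range
  over.\<close>

lemma constricted_neighbours_proper:
  fixes v :: "'b::finite \<Rightarrow> 'g::finite \<Rightarrow> real"
  assumes "CARD('g) = CARD('b)" and "surplus v P S > 0"
  shows "neighbours v P S \<noteq> UNIV"
proof
  assume "neighbours v P S = UNIV"
  moreover have "card S \<le> CARD('g)"
    by (intro card_mono) auto
  ultimately show False
    using assms by (simp add: surplus_def)
qed

text \<open>The old neighbours of \<open>T \<inter> S\<close> and the neighbours of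
  \<open>T - S\<close> outside those of \<open>S\<close> are disjoint and all survive as neighbours
  of \<open>T\<close>. The second group is what \<open>S \<union> T\<close> adds to the neighbours
  of \<open>S\<close>.\<close>

lemma surplus_lower_prices_le:
  assumes "neighbours v P S \<noteq> UNIV" and "S \<noteq> {}"
  shows "surplus v (lower_prices v S P) T \<le>
    surplus v P (T \<inter> S) + surplus v P (S \<union> T) - surplus v P S"
proof -
  let ?N = "neighbours v P" and ?N' = "neighbours v (lower_prices v S P)"
  let ?A = "T \<inter> S" and ?B = "T - S"
  have T: "T = ?A \<union> ?B" and ST: "S \<union> T = S \<union> ?B"
    by auto
  have "?N ?A \<union> (?N ?B - ?N S) \<subseteq> ?N' ?A \<union> ?N' ?B"
    using neighbours_lower_prices_inside[OF assms, of ?A]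
      neighbours_lower_prices_outside[of ?B S v P] by blast
  also have "\<dots> = ?N' T"
    by (subst T) (simp only: neighbours_Un)
  finally have "card (?N ?A \<union> (?N ?B - ?N S)) \<le> card (?N' T)"
    by (intro card_mono) auto
  moreover have "card (?N ?A \<union> (?N ?B - ?N S)) = card (?N ?A) + card (?N ?B - ?N S)"
    using neighbours_mono[of ?A S v P] by (intro card_Un_disjoint) auto
  moreover have "card (?N (S \<union> T)) = card (?N S) + card (?N ?B - ?N S)"
    unfolding ST neighbours_Un by (subst card_Un_disjoint[symmetric]) auto
  moreover have "card T + card S = card ?A + card (S \<union> T)"
    using card_Un_Int[of S T] by (simp add: Int_commute)
  ultimately show ?thesis
    unfolding surplus_def by linarith
qed

lemma skewness_auction_step_less:
  fixes v :: "'b::finite \<Rightarrow> 'g::finite \<Rightarrow> real"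
  assumes "CARD('g) = CARD('b)" and "constricted v P C" and "T \<noteq> {}"
  shows "skewness v (auction_step v P) T < skewness v P (maximally_skewed_set v P)"
proof -
  define S where "S = maximally_skewed_set v P"
  note S = maximally_skewed_set[OF assms(2), folded S_def]
  let ?P' = "lower_prices v S P"
  have proper: "neighbours v P S \<noteq> UNIV"
    using constricted_neighbours_proper[OF assms(1) S(2)] .
  have le: "surplus v ?P' T \<le> surplus v P (T \<inter> S)"
    using surplus_lower_prices_le[OF proper S(1), of T] S(3)[of "S \<union> T"] by linarith
  have cards: "0 < card S" "0 < card T"
    using S(1) assms(3) by (auto simp: card_gt_0_iff)
  \<comment> \<open>If \<open>T \<inter> S\<close> still has maximal surplus, minimality of
    \<open>S\<close> forces \<open>S \<subseteq> T\<close>. For \<open>T = S\<close> the new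
    neighbour lowers the surplus; for larger \<open>T\<close> the term \<open>1 / card T\<close> is
    smaller.\<close>
  have "surplus v ?P' T < surplus v P S \<or> surplus v ?P' T = surplus v P S \<and> card S < card T"
  proof (cases "surplus v P (T \<inter> S) < surplus v P S")
    case True
    then show ?thesis
      using le by linarith
  next
    case False
    then have "card S \<le> card (T \<inter> S)"
      using S(3,4)[of "T \<inter> S"] by linarith
    then have "S \<subseteq> T"
      using card_seteq[of S "T \<inter> S"] by auto
    show ?thesis
    proof (cases "S = T")
      case True
      have "card (neighbours v P S) < card (neighbours v ?P' S)"
        using neighbours_lower_prices_strict[OF proper S(1)] by (intro psubset_card_mono) auto
      then show ?thesis
        using True by (simp add: surplus_def)
    next
      case False
      then have "card S < card T"
        using \<open>S \<subseteq> T\<close> by (intro psubset_card_mono) auto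
      then show ?thesis
        using le S(3)[of "T \<inter> S"] by linarith
    qed
  qed
  then have "skewness v ?P' T < skewness v P S"
  proof
    assume "surplus v ?P' T < surplus v P S"
    then have "real_of_int (surplus v ?P' T) + 1 \<le> real_of_int (surplus v P S)"
      by linarith
    moreover have "1 / real (card T) \<le> 1" "0 < 1 / real (card S)"
      using cards by auto
    ultimately show ?thesis
      unfolding skewness_eq by linarith
  next
    assume "surplus v ?P' T = surplus v P S \<and> card S < card T"
    then show ?thesis
      using cards by (simp add: skewness_eq frac_less2)
  qed
  then show ?thesis
    by (simp add: auction_step_eq S_def)
qed


section \<open>Market-clearing prices stay below the auction prices\<close>

text \<open>The buyer matched to a good has non-negative utility, so the price is at most that
  buyer's valuation.\<close>

lemma market_clearing_le_initial_prices:
  assumes "market_clearing v Q"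
  shows "Q \<le> initial_prices v"
proof (rule le_funI)
  fix j
  obtain h where "\<And>j. h j \<in> neighbours v Q {j}"
    using market_clearing_imp_assignment[OF assms] by blast
  then have "h j \<in> neighbours v Q {j}" .
  then have "0 \<le> v (h j) j - Q j"
    unfolding in_neighbours_iff by blast
  moreover have "v (h j) j \<le> initial_prices v j"
    unfolding initial_prices_def by (intro Max_ge) auto
  ultimately show "Q j \<le> initial_prices v j"
    by linarith
qed

lemma market_clearing_le_auction_step:
  fixes v :: "'b::finite \<Rightarrow> 'g::finite \<Rightarrow> real"
  assumes "CARD('g) = CARD('b)" and "constricted v P C"
    and "market_clearing v Q" and "Q \<le> P"
  shows "Q \<le> auction_step v P"
proof -
  define S where "S = maximally_skewed_set v P"
  note S = maximally_skewed_set[OF assms(2), folded S_def]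
  let ?N = "neighbours v P" and ?d = "price_decrement v P S"
  \<comment> \<open>The claim is that the decrement is at most \<open>e\<close>, the smallest gap
    between \<open>P\<close> and \<open>Q\<close> on \<open>S\<close>; \<open>T\<close> collects the
    goods with this gap.\<close>
  define e where "e = Min ((\<lambda>j. P j - Q j) ` S)"
  define T where "T = {j \<in> S. P j - Q j = e}"
  have e_le: "e \<le> P j - Q j" if "j \<in> S" for j
    unfolding e_def using that by (intro Min_le) auto
  have "e \<in> (\<lambda>j. P j - Q j) ` S"
    using S(1) unfolding e_def by (intro Min_in) auto
  then have "T \<noteq> {}"
    by (auto simp: T_def)
  have "T \<subseteq> S"
    by (auto simp: T_def)
  have "?d \<le> e"
  proof (rule ccontr)
    assume "\<not> ?d \<le> e"
    obtain h where h: "inj h" "\<And>j. h j \<in> neighbours v Q {j}"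
      using market_clearing_imp_assignment[OF assms(3)] by blast
    have "h ` T \<subseteq> ?N S - ?N (S - T)"
    proof
      fix i assume "i \<in> h ` T"
      then obtain j where j: "j \<in> T" "i = h j"
        by blast
      then have pref: "0 \<le> v i j - Q j" "\<And>k. v i k - Q k \<le> v i j - Q j"
        using h(2)[of j] by (auto simp: in_neighbours_iff)
      have Qj: "Q j = P j - e" "j \<in> S"
        using j(1) by (auto simp: T_def)
      have "i \<in> ?N S"
      proof (rule ccontr)
        assume "i \<notin> ?N S"
        \<comment> \<open>Outside utilities only grow from \<open>P\<close> to the lower prices
          \<open>Q\<close>, so they are bounded by the utility of \<open>j\<close> at
          \<open>Q\<close>, which is \<open>v i j - P j + e\<close>. This would give
          \<open>?d \<le> e\<close>.\<close>
        then have "v i j - P j + ?d \<le> outside_utility v P S i"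
          using Qj(2) by (rule price_decrement_le)
        also have "\<dots> \<le> v i j - Q j"
        proof (rule outside_utility_le[OF pref(1)])
          fix k
          show "v i k - P k \<le> v i j - Q j"
            using pref(2)[of k] le_funD[OF assms(4), of k] by linarith
        qed
        finally show False
          using Qj(1) \<open>\<not> ?d \<le> e\<close> by linarith
      qed
      moreover have "i \<notin> ?N (S - T)"
      proof
        assume "i \<in> ?N (S - T)"
        then obtain l where l: "l \<in> S - T" "v i j - P j \<le> v i l - P l"
          by (auto simp: in_neighbours_iff)
        \<comment> \<open>A good of \<open>S - T\<close> is cheapened by more than \<open>e\<close>
          at \<open>Q\<close>, so if it were at least as good as \<open>j\<close> at
          \<open>P\<close>, it would beat \<open>j\<close> at \<open>Q\<close>.\<close>
        then have "e < P l - Q l"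
          using e_le[of l] by (auto simp: T_def)
        then show False
          using l(2) pref(2)[of l] Qj(1) by linarith
      qed
      ultimately show "i \<in> ?N S - ?N (S - T)"
        by blast
    qed
    then have "card (h ` T) \<le> card (?N S - ?N (S - T))"
      by (intro card_mono) auto
    moreover have "card (h ` T) = card T"
      using h(1) by (intro card_image) (auto intro: inj_on_subset)
    moreover have "card (?N S - ?N (S - T)) = card (?N S) - card (?N (S - T))"
      by (intro card_Diff_subset neighbours_mono) auto
    moreover have "card (?N (S - T)) \<le> card (?N S)"
      by (intro card_mono neighbours_mono) auto
    moreover have "card S = card (S - T) + card T"
      using card_Diff_subset[of T S] card_mono[of S T] \<open>T \<subseteq> S\<close> by simp
    moreover have "0 < card T"
      using \<open>T \<noteq> {}\<close> by (simp add: card_gt_0_iff)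
    \<comment> \<open>Removing \<open>T\<close> loses at least as many neighbours as goods, which
      contradicts the minimality of \<open>S\<close>, also when \<open>S - T\<close> is
      empty.\<close>
    ultimately have "surplus v P S \<le> surplus v P (S - T)" "card (S - T) < card S"
      unfolding surplus_def by linarith+
    then show False
      using S(3,4)[of "S - T"] by linarith
  qed
  show ?thesis
  proof (rule le_funI)
    fix j
    show "Q j \<le> auction_step v P j"
      using e_le[of j] \<open>?d \<le> e\<close> le_funD[OF assms(4), of j]
      by (auto simp: auction_step_eq lower_prices_def S_def[symmetric])
  qed
qed


section \<open>Termination and correctness\<close>

text \<open>A finite set, independent of prices, containing every skewness. Size 0 is included,
  where \<open>1 / 0 = 0\<close>; the \<open>itself\<close> argument carries the two types.\<close>

definition skewness_values :: "('b::finite \<times> 'g::finite) itself \<Rightarrow> real set" where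
  "skewness_values _ =
     (\<lambda>(a, b). real a - real b + 1 / real a) ` ({..CARD('g)} \<times> {..CARD('b)})"

lemma skewness_in_values:
  fixes v :: "'b::finite \<Rightarrow> 'g::finite \<Rightarrow> real"
  shows "skewness v P S \<in> skewness_values TYPE('b \<times> 'g)"
  unfolding skewness_values_def skewness_def
  by (rule image_eqI[of _ _ "(card S, card (neighbours v P S))"]) (auto intro: card_mono)

text \<open>Counts the possible skewness values up to the current maximum, turning a strict decrease
  of reals into one of naturals.\<close>

definition auction_rank :: "('b::finite \<Rightarrow> 'g::finite \<Rightarrow> real) \<Rightarrow> ('g \<Rightarrow> real) \<Rightarrow> nat" where
  "auction_rank v P =
     card {x \<in> skewness_values TYPE('b \<times> 'g). \<exists>T. T \<noteq> {} \<and> x \<le> skewness v P T}"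

lemma auction_rank_decreases:
  fixes v :: "'b::finite \<Rightarrow> 'g::finite \<Rightarrow> real"
  assumes "CARD('g) = CARD('b)" and "constricted v P C"
  shows "auction_rank v (auction_step v P) < auction_rank v P"
proof -
  let ?S = "maximally_skewed_set v P"
  let ?R = "\<lambda>P. {x \<in> skewness_values TYPE('b \<times> 'g). \<exists>T. T \<noteq> {} \<and> x \<le> skewness v P T}"
  note less = skewness_auction_step_less[OF assms]
  note S = maximally_skewed_set(1)[OF assms(2)]
  have "?R (auction_step v P) \<subseteq> ?R P"
  proof
    fix x assume x: "x \<in> ?R (auction_step v P)"
    then obtain T where "T \<noteq> {}" "x \<le> skewness v (auction_step v P) T"
      by blast
    then have "x \<le> skewness v P ?S"
      using less[of T] by linarith
    then show "x \<in> ?R P"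
      using S x by blast
  qed
  moreover have "skewness v P ?S \<in> ?R P"
    using S skewness_in_values by blast
  moreover have "skewness v P ?S \<notin> ?R (auction_step v P)"
    using less by (auto simp: not_le)
  moreover have "finite (?R P)"
    by (simp add: skewness_values_def)
  ultimately show ?thesis
    unfolding auction_rank_def by (intro psubset_card_mono) blast+
qed

theorem theorem2:
  fixes v :: "'b::finite \<Rightarrow> 'g::finite \<Rightarrow> real" and m :: nat
  assumes "m \<ge> 1" and "CARD('g) = m" and "CARD('b) = m"
    and "\<And>i j. v i j \<ge> 0"
  shows "\<exists>P. skewed_set_auction v = Some P \<and> maximum_market_clearing v P"
proof -
  have square: "CARD('g) = CARD('b)"
    using assms(2,3) by simp
  let ?b = "\<lambda>P. \<exists>S. constricted v P S"
  have "\<exists>P. while_option ?b (auction_step v) (initial_prices v) = Some P"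
    by (rule measure_while_option_Some[where P = "\<lambda>_. True" and f = "auction_rank v"])
      (use auction_rank_decreases[OF square] in auto)
  then obtain P where P: "while_option ?b (auction_step v) (initial_prices v) = Some P"
    by blast
  \<comment> \<open>This upper bound is the loop invariant; it is carried to the final prices, which
    are themselves market clearing by the exit condition.\<close>
  have "\<forall>Q. market_clearing v Q \<longrightarrow> Q \<le> P"
    by (rule while_option_rule[OF _ P])
      (blast intro: market_clearing_le_auction_step[OF square] market_clearing_le_initial_prices)+
  moreover have "market_clearing v P"
    using market_clearing_if_not_constricted[OF square] while_option_stop[OF P] by blast
  ultimately show ?thesis
    using P by (auto simp: skewed_set_auction_def maximum_market_clearing_def)
qed

end
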